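(* Let $G$ and $H$ be finite simple connected graphs. Then: (1) $G$ and $H$ are both $1$-CDDR if and only if the strong product $G\boxtimes H$ is $1$-CDDR. (2) $G$ and $H$ are both $1$-CDDR if and only if the Cartesian product $G\square H$ is $1$-CDDR. (3) If $G$ and $H$ are both $1$-CDDR and both DWR, and at least one of them is non-bipartite, then the direct product $G\times H$ is $1$-CDDR. (4) If $|V(G)|\ge 2$ and $1\le i\le\operatorname{diam}(G[H])$, then ($G$ is $i$-CDDR and $H$ is regular) if and only if the lexicographic product $G[H]$ is $i$-CDDR.
   Context: For a graph $G$ and integer $i\ge 0$, $A_i(G)$ is the $0/1$ matrix indexed by $V(G)$ with $(u,v)$-entry $1$ iff $d(u,v)=i$ (so $A_i(G)=0$ for $i>\operatorname{diam}(G)$); vertices in different components, should a product be disconnected, are at distance $\infty$. $G$ is $i$-CDDR if $A_i(G)A_j(G)=A_j(G)A_i(G)$ for all $j\geq 0$; equivalently $|\Gamma_i(u)\cap\Gamma_j(v)|=|\Gamma_i(v)\cap\Gamma_j(u)|$ for all vertices $u,v$ and all $j\ge 1$, where $\Gamma_i(u)$ is the set of vertices at distance exactly $i$ from $u$. $G$ is DWR (distance walk regular) if for all vertices $u,v$ and all $k\in\mathbb{N}$ the existence of a walk of length $k$ between $u$ and $v$ depends only on $k$ and $d(u,v)$. All products have vertex set $V(G)\times V(H)$, and $(g_1,h_1)\sim(g_2,h_2)$ iff: strong $G\boxtimes H$: ($g_1\sim g_2$, $h_1=h_2$) or ($g_1=g_2$, $h_1\sim h_2$) or ($g_1\sim g_2$,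 $h_1\sim h_2$); Cartesian $G\square H$: ($g_1=g_2$, $h_1\sim h_2$) or ($h_1=h_2$, $g_1\sim g_2$); direct $G\times H$: $g_1\sim g_2$ and $h_1\sim h_2$; lexicographic $G[H]$: $g_1\sim g_2$, or ($g_1=g_2$ and $h_1\sim h_2$). *)

theory Defs
  imports "HOL-Analysis.Finite_Cartesian_Product" "Graph_Theory.Graph_Theory"
begin

text \<open>
  Finite simple graphs are the symmetric digraphs of locale \<^locale>\<open>pair_graph\<close>: an edge is a
  pair of opposite arcs. The vertex set is a subset of a finite type, which makes the matrices of
  HOL-Analysis available. \<^const>\<open>Digraph_Component.connected\<close> entails a nonempty vertex set.
\<close>

definition gdist :: "'a pair_pre_digraph \<Rightarrow> 'a \<Rightarrow> 'a \<Rightarrow> ereal" where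
  "gdist G u v = wf_digraph.\<mu> (with_proj G) (\<lambda>_. 1) u v"

definition diam :: "'a pair_pre_digraph \<Rightarrow> ereal" where
  "diam G = (SUP u\<in>pverts G. SUP v\<in>pverts G. gdist G u v)"

text \<open>
  Rows and columns outside the vertex set are zero, hence do not affect products. Note
  that the distance between vertices of different components is \<open>\<infinity>\<close>.
\<close>

definition dist_matrix :: "('a::finite) pair_pre_digraph \<Rightarrow> nat \<Rightarrow> int ^ 'a ^ 'a" where
  "dist_matrix G i =
     (\<chi> u v. if u \<in> pverts G \<and> v \<in> pverts G \<and> gdist G u v = ereal (real i) then 1 else 0)"

definition CDDR :: "nat \<Rightarrow> ('a::finite) pair_pre_digraph \<Rightarrow> bool" where
  "CDDR i G \<longleftrightarrow>
     (\<forall>j. dist_matrix G i ** dist_matrix G j = dist_matrix G j ** dist_matrix G i)"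

definition has_walk :: "'a pair_pre_digraph \<Rightarrow> nat \<Rightarrow> 'a \<Rightarrow> 'a \<Rightarrow> bool" where
  "has_walk G k u v \<longleftrightarrow> (\<exists>p. pre_digraph.awalk (with_proj G) u p v \<and> length p = k)"

definition DWR :: "'a pair_pre_digraph \<Rightarrow> bool" where
  "DWR G \<longleftrightarrow>
     (\<forall>k. \<forall>u\<in>pverts G. \<forall>v\<in>pverts G. \<forall>u'\<in>pverts G. \<forall>v'\<in>pverts G.
        gdist G u v = gdist G u' v' \<longrightarrow> (has_walk G k u v \<longleftrightarrow> has_walk G k u' v'))"

text \<open>A part may be empty, so the one-vertex graph is bipartite.\<close>

definition bipartite :: "'a pair_pre_digraph \<Rightarrow> bool" where
  "bipartite G \<longleftrightarrow>
     (\<exists>X Y. X \<union> Y = pverts G \<and> X \<inter> Y = {} \<and> parcs G \<subseteq> X \<times> Y \<union> Y \<times> X)"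

text \<open>In a symmetric digraph the out-degree of a vertex is its degree as a graph vertex.\<close>

definition regular :: "'a pair_pre_digraph \<Rightarrow> bool" where
  "regular G \<longleftrightarrow> (\<exists>d. \<forall>v\<in>pverts G. out_degree (with_proj G) v = d)"

definition strong_product ::
    "'a pair_pre_digraph \<Rightarrow> 'b pair_pre_digraph \<Rightarrow> ('a \<times> 'b) pair_pre_digraph" where
  "strong_product G H =
     \<lparr> pverts = pverts G \<times> pverts H,
       parcs = {((g1, h1), (g2, h2)) | g1 h1 g2 h2.
         (g1, h1) \<in> pverts G \<times> pverts H \<and> (g2, h2) \<in> pverts G \<times> pverts H \<and>
         ((g1, g2) \<in> parcs G \<and> h1 = h2 \<or> g1 = g2 \<and> (h1, h2) \<in> parcs H \<or>
          (g1, g2) \<in> parcs G \<and> (h1, h2) \<in> parcs H)} \<rparr>"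

definition cartesian_product ::
    "'a pair_pre_digraph \<Rightarrow> 'b pair_pre_digraph \<Rightarrow> ('a \<times> 'b) pair_pre_digraph" where
  "cartesian_product G H =
     \<lparr> pverts = pverts G \<times> pverts H,
       parcs = {((g1, h1), (g2, h2)) | g1 h1 g2 h2.
         (g1, h1) \<in> pverts G \<times> pverts H \<and> (g2, h2) \<in> pverts G \<times> pverts H \<and>
         (g1 = g2 \<and> (h1, h2) \<in> parcs H \<or> h1 = h2 \<and> (g1, g2) \<in> parcs G)} \<rparr>"

definition direct_product ::
    "'a pair_pre_digraph \<Rightarrow> 'b pair_pre_digraph \<Rightarrow> ('a \<times> 'b) pair_pre_digraph" where
  "direct_product G H =
     \<lparr> pverts = pverts G \<times> pverts H,
       parcs = {((g1, h1), (g2, h2)) | g1 h1 g2 h2.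
         (g1, h1) \<in> pverts G \<times> pverts H \<and> (g2, h2) \<in> pverts G \<times> pverts H \<and>
         (g1, g2) \<in> parcs G \<and> (h1, h2) \<in> parcs H} \<rparr>"

definition lexicographic_product ::
    "'a pair_pre_digraph \<Rightarrow> 'b pair_pre_digraph \<Rightarrow> ('a \<times> 'b) pair_pre_digraph" where
  "lexicographic_product G H =
     \<lparr> pverts = pverts G \<times> pverts H,
       parcs = {((g1, h1), (g2, h2)) | g1 h1 g2 h2.
         (g1, h1) \<in> pverts G \<times> pverts H \<and> (g2, h2) \<in> pverts G \<times> pverts H \<and>
         ((g1, g2) \<in> parcs G \<or> g1 = g2 \<and> (h1, h2) \<in> parcs H)} \<rparr>"

text \<open>
  \<^const>\<open>wf_digraph.\<mu>\<close> is characterised only for well-formed digraphs, so \<^const>\<open>gdist\<close> on the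
  products is meaningful because these are again simple graphs.
\<close>

lemma gdist_eq:
  assumes "pair_graph G"
  shows "gdist G u v = (INF p\<in>{p. pre_digraph.awalk (with_proj G) u p v}. ereal (real (length p)))"
proof -
  interpret pair_graph G by fact
  have "awalk_cost (\<lambda>_. 1) p = real (length p)" for p :: "('a \<times> 'a) list"
    by (induction p) auto
  then show ?thesis
    using wf_digraph.\<mu>_def[OF wf_digraph, of "\<lambda>_. 1" u v] by (simp add: gdist_def)
qed

lemma pair_graphI:
  assumes "finite (pverts G)" "\<And>u v. (u, v) \<in> parcs G \<Longrightarrow> u \<in> pverts G \<and> v \<in> pverts G"
    and "\<And>u v. (u, v) \<in> parcs G \<Longrightarrow> (v, u) \<in> parcs G" "\<And>u. (u, u) \<notin> parcs G"
  shows "pair_graph G"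
proof -
  have "parcs G \<subseteq> pverts G \<times> pverts G"
    using assms(2) by auto
  then have "finite (parcs G)"
    using assms(1) by (meson finite_SigmaI finite_subset)
  moreover have "symmetric (with_proj G)"
    using assms(3) unfolding symmetric_def by (auto intro: symI)
  ultimately show ?thesis
    using assms by unfold_locales fastforce+
qed

lemma pair_graphD:
  assumes "pair_graph G"
  shows "finite (pverts G)" "(u, v) \<in> parcs G \<Longrightarrow> (v, u) \<in> parcs G" "(u, u) \<notin> parcs G"
proof -
  interpret pair_graph G by fact
  show "finite (pverts G)" "(u, v) \<in> parcs G \<Longrightarrow> (v, u) \<in> parcs G" "(u, u) \<notin> parcs G"
    using no_loops' arcs_symmetric by auto
qed

lemma pair_graph_strong_product:
  assumes "pair_graph G" "pair_graph H"
  shows "pair_graph (strong_product G H)"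
  using pair_graphD[OF assms(1)] pair_graphD[OF assms(2)]
  by (intro pair_graphI) (auto simp: strong_product_def)

lemma pair_graph_cartesian_product:
  assumes "pair_graph G" "pair_graph H"
  shows "pair_graph (cartesian_product G H)"
  using pair_graphD[OF assms(1)] pair_graphD[OF assms(2)]
  by (intro pair_graphI) (auto simp: cartesian_product_def)

lemma pair_graph_direct_product:
  assumes "pair_graph G" "pair_graph H"
  shows "pair_graph (direct_product G H)"
  using pair_graphD[OF assms(1)] pair_graphD[OF assms(2)]
  by (intro pair_graphI) (auto simp: direct_product_def)

lemma pair_graph_lexicographic_product:
  assumes "pair_graph G" "pair_graph H"
  shows "pair_graph (lexicographic_product G H)"
  using pair_graphD[OF assms(1)] pair_graphD[OF assms(2)]
  by (intro pair_graphI) (auto simp: lexicographic_product_def)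

end

theory Submission
  imports Defs
begin

text \<open>
  Write \<open>D\<^sub>c\<close> for the 0/1 matrix of the pairs of vertices at distance \<open>c\<close>; a graph is \<open>i\<close>-CDDR if
  \<open>D\<^sub>i\<close> commutes with every \<open>D\<^sub>c\<close>. A product matrix \<open>A \<otimes> B\<close> (Kronecker product) commutes with every
  \<open>D\<^sub>a \<otimes> D\<^sub>b\<close> as soon as \<open>A\<close> commutes with every \<open>D\<^sub>a\<close> and \<open>B\<close> with every \<open>D\<^sub>b\<close>
  (\<open>balanced_tensor\<close>). This settles the implications from the factors to the product, because in
  each of the four products, under the assumptions of the theorem,

  \<^item> the distance of two vertices is a function \<open>F\<close> of the distances of their coordinates, so a
    distance class of the product is a sum of matrices \<open>D\<^sub>a \<otimes> D\<^sub>b\<close>;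
  \<^item> the matrix \<open>D\<^sub>i\<close> of the product is a sum of matrices \<open>A \<otimes> B\<close> whose factors commute with the
    distance classes of \<open>G\<close> and \<open>H\<close>: they are classes themselves, identities, or all-ones matrices.

  For the strong and the Cartesian product \<open>F\<close> is the maximum and the sum. For the direct product
  a walk is a pair of walks of equal length, and \<open>F\<close> exists because distance walk regularity lets the
  possible lengths of a walk be read off the distance of its ends. In the lexicographic product
  two distinct vertices with the same first coordinate are adjacent, or at distance two via a neighbouring
  copy of the second factor; so \<open>F a b\<close> is \<open>a\<close> unless \<open>a = 0\<close>, and then it is \<open>b\<close> truncated at two.
  The all-ones matrix commutes with the classes of the truncated distance exactly when the second
  factor is regular.

  For the converses the entries of the product matrices are compared at a pair \<open>(u, x)\<close>, \<open>(v, x)\<close> of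
  vertices with equal second coordinate. For every class that matters, such an entry is a positive
  number depending only on \<open>x\<close>, times the entry of the first factor at \<open>(u, v)\<close>, plus terms
  symmetric in \<open>u\<close> and \<open>v\<close>; symmetry of the product matrix therefore passes to the factor
  (\<open>balanced_first_factor\<close>, \<open>card_lex_shells\<close>). Regularity in the lexicographic case is the symmetry
  of the remaining terms at pairs \<open>(u, x)\<close>, \<open>(v, y)\<close> with \<open>u\<close> and \<open>v\<close> at a suitable distance.
\<close>

section \<open>Relations that commute with the classes of a distance\<close>

text \<open>
  Let \<open>A\<close> and \<open>D\<^sub>c\<close> be the 0/1 matrices of \<open>R\<close> and of the pairs at distance \<open>c\<close>. The left count is the entry
  of \<open>A D\<^sub>c\<close> at \<open>(u, v)\<close>. When \<open>R\<close> and \<open>d\<close> are symmetric, the right count is the entry of \<open>D\<^sub>c A\<close>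
  there, and the condition says that \<open>A\<close> commutes with every \<open>D\<^sub>c\<close>.
\<close>

definition balanced :: "'a set \<Rightarrow> ('a \<Rightarrow> 'a \<Rightarrow> 'c) \<Rightarrow> ('a \<Rightarrow> 'a \<Rightarrow> bool) \<Rightarrow> bool" where
  "balanced V d R \<longleftrightarrow>
     (\<forall>u\<in>V. \<forall>v\<in>V. \<forall>c. card {w \<in> V. R u w \<and> d w v = c} = card {w \<in> V. R v w \<and> d w u = c})"

lemma balancedI:
  assumes "\<And>u v c. u \<in> V \<Longrightarrow> v \<in> V \<Longrightarrow>
    card {w \<in> V. R u w \<and> d w v = c} = card {w \<in> V. R v w \<and> d w u = c}"
  shows "balanced V d R"
  using assms by (simp add: balanced_def)

lemma balancedD:
  assumes "balanced V d R" "u \<in> V" "v \<in> V"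
  shows "card {w \<in> V. R u w \<and> d w v = c} = card {w \<in> V. R v w \<and> d w u = c}"
  using assms by (simp add: balanced_def)

lemma balanced_cong:
  assumes "\<And>u v. u \<in> V \<Longrightarrow> v \<in> V \<Longrightarrow> d u v = d' u v"
    and "\<And>u v. u \<in> V \<Longrightarrow> v \<in> V \<Longrightarrow> R u v \<longleftrightarrow> R' u v"
  shows "balanced V d R \<longleftrightarrow> balanced V d' R'"
proof -
  have "{w \<in> V. R u w \<and> d w v = c} = {w \<in> V. R' u w \<and> d' w v = c}" if "u \<in> V" "v \<in> V" for u v c
    using assms that by auto
  then show ?thesis
    by (simp add: balanced_def)
qed

text \<open>
  Any function of the distance is a linear combination of the indicators of its classes, so the
  equality of counts extends from the indicators to all functions.
\<close>

lemma balanced_sum: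
  fixes f :: "'c \<Rightarrow> nat"
  assumes "finite V" "balanced V d R" "u \<in> V" "v \<in> V"
  shows "(\<Sum>w | w \<in> V \<and> R u w. f (d w v)) = (\<Sum>w | w \<in> V \<and> R v w. f (d w u))"
proof -
  let ?C = "(\<lambda>w. d w v) ` V \<union> (\<lambda>w. d w u) ` V"
  have count: "(\<Sum>w | w \<in> V \<and> R a w. f (d w b)) = (\<Sum>c\<in>?C. card {w \<in> V. R a w \<and> d w b = c} * f c)"
    if "b \<in> {u, v}" for a b
  proof -
    have "(\<Sum>w | w \<in> V \<and> R a w. f (d w b))
        = (\<Sum>c\<in>?C. \<Sum>w | w \<in> {w \<in> V. R a w} \<and> d w b = c. f (d w b))"
      using assms(1) that by (intro sum.group[symmetric]) auto
    also have "\<dots> = (\<Sum>c\<in>?C. card {w \<in> V. R a w \<and> d w b = c} * f c)"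
      by (intro sum.cong refl) (simp add: conj_assoc)
    finally show ?thesis .
  qed
  show ?thesis
    using balancedD[OF assms(2-4)] by (simp add: count)
qed

text \<open>
  The count in the product is a double sum over both factors of a function of the two distances;
  exchanging the end points one coordinate at a time is \<open>balanced_sum\<close> applied in each factor.
\<close>

lemma balanced_tensor:
  assumes "finite V" "finite W" "balanced V d R" "balanced W e S"
  shows "balanced (V \<times> W) (\<lambda>p q. F (d (fst p) (fst q)) (e (snd p) (snd q)))
           (\<lambda>p q. R (fst p) (fst q) \<and> S (snd p) (snd q))"
proof (rule balancedI)
  fix p q c
  assume pq: "p \<in> V \<times> W" "q \<in> V \<times> W"
  then have mem: "fst p \<in> V" "snd p \<in> W" "fst q \<in> V" "snd q \<in> W"
    by auto
  define f where "f a b = (if F a b = c then 1 else 0::nat)" for a b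
  let ?N = "\<lambda>p q. card {r \<in> V \<times> W. (R (fst p) (fst r) \<and> S (snd p) (snd r))
    \<and> F (d (fst r) (fst q)) (e (snd r) (snd q)) = c}"
  have count: "?N p q = (\<Sum>w | w \<in> V \<and> R (fst p) w. \<Sum>z | z \<in> W \<and> S (snd p) z.
      f (d w (fst q)) (e z (snd q)))" for p q
  proof -
    let ?A = "{w \<in> V. R (fst p) w}" and ?B = "{z \<in> W. S (snd p) z}"
    have "{r \<in> V \<times> W. (R (fst p) (fst r) \<and> S (snd p) (snd r))
          \<and> F (d (fst r) (fst q)) (e (snd r) (snd q)) = c}
        = {r \<in> ?A \<times> ?B. F (d (fst r) (fst q)) (e (snd r) (snd q)) = c}"
      by auto
    moreover have "finite (?A \<times> ?B)"
      using assms(1,2) by simp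
    ultimately have "?N p q = (\<Sum>r\<in>?A \<times> ?B. f (d (fst r) (fst q)) (e (snd r) (snd q)))"
      by (simp add: f_def sum.If_cases Int_def)
    then show ?thesis
      by (simp add: sum.cartesian_product case_prod_beta)
  qed
  have "?N p q = (\<Sum>w | w \<in> V \<and> R (fst q) w. \<Sum>z | z \<in> W \<and> S (snd p) z.
      f (d w (fst p)) (e z (snd q)))"
    unfolding count using balanced_sum[OF assms(1,3) mem(1,3),
        of "\<lambda>a. \<Sum>z | z \<in> W \<and> S (snd p) z. f a (e z (snd q))"] .
  also have "\<dots> = ?N q p"
    unfolding count by (intro sum.cong refl balanced_sum[OF assms(2,4) mem(2,4)])
  finally show "?N p q = ?N q p" .
qed

lemma balanced_Id:
  assumes "\<And>u v. u \<in> V \<Longrightarrow> v \<in> V \<Longrightarrow> d u v = d v u"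
  shows "balanced V d (=)"
proof (rule balancedI)
  fix u v c assume "u \<in> V" "v \<in> V"
  then have "{w \<in> V. u = w \<and> d w v = c} = (if d u v = c then {u} else {})"
    "{w \<in> V. v = w \<and> d w u = c} = (if d u v = c then {v} else {})"
    using assms by auto
  then show "card {w \<in> V. u = w \<and> d w v = c} = card {w \<in> V. v = w \<and> d w u = c}"
    by simp
qed

text \<open>
  From right to left this assembles a shell from its parts; from left to right it removes a part, as
  in the passage from a graph to its complement.
\<close>

lemma balanced_disjoint_union_iff:
  assumes "finite V" "balanced V d S"
    and "\<And>u v. u \<in> V \<Longrightarrow> v \<in> V \<Longrightarrow> \<not> (R u v \<and> S u v)"
  shows "balanced V d (\<lambda>u v. R u v \<or> S u v) \<longleftrightarrow> balanced V d R"
proof -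
  have "card {w \<in> V. (R u w \<or> S u w) \<and> d w v = c}
      = card {w \<in> V. R u w \<and> d w v = c} + card {w \<in> V. S u w \<and> d w v = c}"
    if "u \<in> V" for u v c
  proof -
    have "{w \<in> V. (R u w \<or> S u w) \<and> d w v = c}
        = {w \<in> V. R u w \<and> d w v = c} \<union> {w \<in> V. S u w \<and> d w v = c}"
      by auto
    then show ?thesis
      using assms(1,3) that by (subst card_Un_disjoint[symmetric]) auto
  qed
  then show ?thesis
    using balancedD[OF assms(2)] by (simp add: balanced_def)
qed

text \<open>
  The class of distance zero is the identity and the class of distance \<open>i\<close> is the shell itself; every
  matrix commutes with the identity and with itself, so the other classes decide.
\<close>

lemma balanced_shellI:
  fixes d :: "'a \<Rightarrow> 'a \<Rightarrow> nat"
  assumes sym: "\<And>u v. u \<in> V \<Longrightarrow> v \<in> V \<Longrightarrow> d u v = d v u"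
    and zero: "\<And>u v. u \<in> V \<Longrightarrow> v \<in> V \<Longrightarrow> d u v = 0 \<longleftrightarrow> u = v"
    and shell: "\<And>u v j. u \<in> V \<Longrightarrow> v \<in> V \<Longrightarrow> j \<noteq> 0 \<Longrightarrow> j \<noteq> i \<Longrightarrow>
      card {w \<in> V. d u w = i \<and> d w v = j} = card {w \<in> V. d v w = i \<and> d w u = j}"
  shows "balanced V d (\<lambda>u w. d u w = i)"
proof (rule balancedI)
  fix u v j assume uv: "u \<in> V" "v \<in> V"
  consider "j = 0" | "j = i" | "j \<noteq> 0" "j \<noteq> i" by blast
  then show "card {w \<in> V. d u w = i \<and> d w v = j} = card {w \<in> V. d v w = i \<and> d w u = j}"
  proof cases
    case 1
    then have "{w \<in> V. d u w = i \<and> d w v = j} = (if d u v = i then {v} else {})"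
      "{w \<in> V. d v w = i \<and> d w u = j} = (if d u v = i then {u} else {})"
      using uv zero sym by auto
    then show ?thesis by simp
  next
    case 2
    then have "{w \<in> V. d u w = i \<and> d w v = j} = {w \<in> V. d v w = i \<and> d w u = j}"
      using uv sym by auto
    then show ?thesis by simp
  next
    case 3
    then show ?thesis using shell uv by blast
  qed
qed

lemma balanced_swap:
  assumes "balanced (V \<times> W) D R"
  shows "balanced (W \<times> V) (\<lambda>p q. D (prod.swap p) (prod.swap q)) (\<lambda>p q. R (prod.swap p) (prod.swap q))"
proof (rule balancedI)
  fix p q c assume pq: "p \<in> W \<times> V" "q \<in> W \<times> V"
  have "card {r \<in> W \<times> V. R a (prod.swap r) \<and> D (prod.swap r) b = c}
      = card {r \<in> V \<times> W. R a r \<and> D r b = c}" for a b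
    by (intro bij_betw_same_card[of prod.swap] bij_betw_byWitness[where f' = prod.swap]) auto
  moreover have "prod.swap p \<in> V \<times> W" "prod.swap q \<in> V \<times> W"
    using pq by auto
  ultimately show "card {r \<in> W \<times> V. R (prod.swap p) (prod.swap r) \<and> D (prod.swap r) (prod.swap q) = c}
      = card {r \<in> W \<times> V. R (prod.swap q) (prod.swap r) \<and> D (prod.swap r) (prod.swap p) = c}"
    using balancedD[OF assms] by simp
qed

section \<open>Walks and distances\<close>

lemma has_walk_0_iff:
  assumes "pair_graph G"
  shows "has_walk G 0 u v \<longleftrightarrow> u = v \<and> u \<in> pverts G"
proof -
  interpret pair_graph G by fact
  show ?thesis
    by (auto simp: has_walk_def awalk_Nil_iff)
qed

lemma has_walk_Suc_iff:
  assumes "pair_graph G"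
  shows "has_walk G (Suc k) u v \<longleftrightarrow> (\<exists>w. (u, w) \<in> parcs G \<and> has_walk G k w v)"
proof -
  interpret pair_graph G by fact
  have "has_walk G (Suc k) u v \<longleftrightarrow> (\<exists>e p. awalk u (e # p) v \<and> length p = k)"
    unfolding has_walk_def by (metis length_Suc_conv)
  also have "\<dots> \<longleftrightarrow> (\<exists>w. (u, w) \<in> parcs G \<and> has_walk G k w v)"
    by (auto simp: has_walk_def awalk_Cons_iff)
  finally show ?thesis .
qed

lemma gdist_eq_INF_has_walk:
  assumes "pair_graph G"
  shows "gdist G u v = (INF k\<in>{k. has_walk G k u v}. ereal (real k))"
proof -
  have "{k. has_walk G k u v} = length ` {p. pre_digraph.awalk (with_proj G) u p v}"
    by (auto simp: has_walk_def)
  then show ?thesis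
    by (simp add: gdist_eq[OF assms] image_image)
qed

lemma gdist_eq_nat_iff:
  assumes "pair_graph G"
  shows "gdist G u v = ereal (real n) \<longleftrightarrow> has_walk G n u v \<and> (\<forall>k. has_walk G k u v \<longrightarrow> n \<le> k)"
proof -
  let ?K = "{k. has_walk G k u v}"
  have least: "gdist G u v = ereal (real m)" if "m \<in> ?K" "\<And>k. k \<in> ?K \<Longrightarrow> m \<le> k" for m
    unfolding gdist_eq_INF_has_walk[OF assms] using that by (intro antisym INF_lower2[of m] INF_greatest) auto
  show ?thesis
  proof (cases "?K = {}")
    case True
    then show ?thesis
      by (simp add: gdist_eq_INF_has_walk[OF assms] top_ereal_def)
  next
    case False
    define m where "m = (LEAST k. k \<in> ?K)"
    have m: "m \<in> ?K" "\<And>k. k \<in> ?K \<Longrightarrow> m \<le> k"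
      using False LeastI_ex[of "\<lambda>k. k \<in> ?K"] Least_le[of "\<lambda>k. k \<in> ?K"] unfolding m_def by auto
    then show ?thesis
      using least[OF m] by (auto intro: antisym)
  qed
qed

lemma has_walk_sym:
  assumes "pair_graph G"
  shows "has_walk G k u v \<longleftrightarrow> has_walk G k v u"
proof -
  interpret pair_graph G by fact
  have len: "length (rev_path p) = length p" for p :: "('a \<times> 'a) list"
    by (induction p) auto
  have "has_walk G k b a" if walk: "has_walk G k a b" for a b
  proof -
    obtain p where "awalk a p b" "length p = k"
      using walk by (auto simp: has_walk_def)
    then show ?thesis
      unfolding has_walk_def by (intro exI[of _ "rev_path p"]) (simp add: len)
  qed
  then show ?thesis
    by blast
qed

lemma gdist_sym: "pair_graph G \<Longrightarrow> gdist G u v = gdist G v u"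
  by (simp add: gdist_eq_INF_has_walk has_walk_sym)

lemma CDDR_iff_card:
  assumes "pair_graph G"
  shows "CDDR i G \<longleftrightarrow> (\<forall>j. \<forall>u\<in>pverts G. \<forall>v\<in>pverts G.
    card {w \<in> pverts G. gdist G u w = ereal (real i) \<and> gdist G w v = ereal (real j)} =
    card {w \<in> pverts G. gdist G v w = ereal (real i) \<and> gdist G w u = ereal (real j)})"
proof -
  let ?N = "\<lambda>i j u v. card {w \<in> pverts G. gdist G u w = ereal (real i) \<and> gdist G w v = ereal (real j)}"
  have entry: "(dist_matrix G i ** dist_matrix G j) $ u $ v
      = (if u \<in> pverts G \<and> v \<in> pverts G then int (?N i j u v) else 0)" for i j u v
  proof -
    have "(dist_matrix G i ** dist_matrix G j) $ u $ v
      = (\<Sum>w\<in>UNIV. if w \<in> {w. u \<in> pverts G \<and> v \<in> pverts G \<and> w \<in> pverts G \<and>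
           gdist G u w = ereal (real i) \<and> gdist G w v = ereal (real j)} then 1 else 0)"
      unfolding matrix_matrix_mult_def dist_matrix_def by (auto intro!: sum.cong)
    also have "\<dots> = int (card {w. u \<in> pverts G \<and> v \<in> pverts G \<and> w \<in> pverts G \<and>
           gdist G u w = ereal (real i) \<and> gdist G w v = ereal (real j)})"
      by (simp add: sum.If_cases)
    finally show ?thesis
      by auto
  qed
  have "?N j i u v = card {w \<in> pverts G. gdist G v w = ereal (real i) \<and> gdist G w u = ereal (real j)}" for j u v
    using gdist_sym[OF assms] by (metis (no_types, lifting))
  then show ?thesis
    unfolding CDDR_def vec_eq_iff entry by auto
qed

lemma gdist_eq_one_iff:
  assumes "pair_graph G"
  shows "gdist G u v = ereal (real 1) \<longleftrightarrow> (u, v) \<in> parcs G"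
proof -
  interpret pair_graph G by fact
  have "has_walk G 1 u v \<longleftrightarrow> (u, v) \<in> parcs G"
    using in_arcsD2 by (auto simp: has_walk_Suc_iff[OF assms] has_walk_0_iff[OF assms])
  moreover have "\<not> has_walk G 0 u v" if "(u, v) \<in> parcs G"
    using that no_loops' by (auto simp: has_walk_0_iff[OF assms])
  ultimately show ?thesis
    unfolding gdist_eq_nat_iff[OF assms] by (metis One_nat_def Suc_leI gr0I)
qed

text \<open>
  On a connected graph all distances are finite, and arithmetic is simpler with a natural-valued
  representative \<open>d\<close> of the extended real distance; only its values on the vertices are constrained.
\<close>

locale graph_distance =
  fixes G :: "'a pair_pre_digraph" and d :: "'a \<Rightarrow> 'a \<Rightarrow> nat"
  assumes graph: "pair_graph G"
    and gdist_eq_d: "u \<in> pverts G \<Longrightarrow> v \<in> pverts G \<Longrightarrow> gdist G u v = ereal (real (d u v))"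
begin

sublocale pair_graph G
  by (rule graph)

lemma finite_V: "finite (pverts G)"
  using pair_graphD(1)[OF graph] .

lemma arcD: "(u, v) \<in> parcs G \<Longrightarrow> u \<in> pverts G \<and> v \<in> pverts G"
  using in_arcsD1 in_arcsD2 by blast

lemma has_walk_d: "u \<in> pverts G \<Longrightarrow> v \<in> pverts G \<Longrightarrow> has_walk G (d u v) u v"
  using gdist_eq_d gdist_eq_nat_iff[OF graph] by blast

lemma d_le: "u \<in> pverts G \<Longrightarrow> v \<in> pverts G \<Longrightarrow> has_walk G k u v \<Longrightarrow> d u v \<le> k"
  using gdist_eq_d gdist_eq_nat_iff[OF graph] by blast

lemma d_sym: "u \<in> pverts G \<Longrightarrow> v \<in> pverts G \<Longrightarrow> d u v = d v u"
  using gdist_eq_d gdist_sym[OF graph] by (metis ereal.inject of_nat_eq_iff)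

lemma d_eq_0_iff: "u \<in> pverts G \<Longrightarrow> v \<in> pverts G \<Longrightarrow> d u v = 0 \<longleftrightarrow> u = v"
  using has_walk_d d_le has_walk_0_iff[OF graph] by (metis le_zero_eq)

lemma d_self [simp]: "u \<in> pverts G \<Longrightarrow> d u u = 0"
  by (simp add: d_eq_0_iff)

lemma d_eq_1_iff: "u \<in> pverts G \<Longrightarrow> v \<in> pverts G \<Longrightarrow> d u v = 1 \<longleftrightarrow> (u, v) \<in> parcs G"
  using gdist_eq_d gdist_eq_one_iff[OF graph] by (metis ereal.inject of_nat_eq_iff)

lemma d_step_le: "(u, w) \<in> parcs G \<Longrightarrow> v \<in> pverts G \<Longrightarrow> d u v \<le> Suc (d w v)"
  using arcD has_walk_d d_le has_walk_Suc_iff[OF graph] by blast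

lemma d_descend:
  assumes "u \<in> pverts G" "v \<in> pverts G" "d u v = Suc n"
  obtains w where "(u, w) \<in> parcs G" "d w v = n"
proof -
  obtain w where w: "(u, w) \<in> parcs G" "has_walk G n w v"
    using has_walk_d[OF assms(1,2)] assms(3) has_walk_Suc_iff[OF graph] by auto
  then show ?thesis
    using that d_le[of w v n] d_step_le[OF w(1) assms(2)] arcD[OF w(1)] assms by auto
qed

end

text \<open>
  A certificate for distance functions: along an arc the value drops by at most one, so a walk to
  \<open>v\<close> is at least as long as the value at its start; and a value above zero can be lowered
  along some arc, which gives a walk of exactly that length.
\<close>

lemma graph_distanceI:
  assumes graph: "pair_graph G"
    and zero: "\<And>u v. u \<in> pverts G \<Longrightarrow> v \<in> pverts G \<Longrightarrow> d u v = 0 \<longleftrightarrow> u = v"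
    and step: "\<And>u w v. (u, w) \<in> parcs G \<Longrightarrow> v \<in> pverts G \<Longrightarrow> d u v \<le> Suc (d w v)"
    and descend: "\<And>u v. u \<in> pverts G \<Longrightarrow> v \<in> pverts G \<Longrightarrow> d u v \<noteq> 0 \<Longrightarrow>
      \<exists>w. (u, w) \<in> parcs G \<and> d w v < d u v"
  shows "graph_distance G d"
proof (rule graph_distance.intro)
  interpret pair_graph G by (rule graph)
  show "pair_graph G" by (rule graph)
  fix u v assume uv: "u \<in> pverts G" "v \<in> pverts G"
  have "d u v \<le> k" if "has_walk G k u v" for k
    using that uv(1)
  proof (induction k arbitrary: u)
    case 0
    then show ?case
      using zero by (auto simp: has_walk_0_iff[OF graph])
  next
    case (Suc k)
    then obtain w where w: "(u, w) \<in> parcs G" "has_walk G k w v"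
      by (auto simp: has_walk_Suc_iff[OF graph])
    then show ?case
      using Suc.IH[OF w(2)] step[OF w(1) uv(2)] in_arcsD2 by force
  qed
  moreover have "has_walk G (d u v) u v"
    using uv(1)
  proof (induction "d u v" arbitrary: u)
    case 0
    then show ?case
      using zero uv(2) by (metis has_walk_0_iff[OF graph])
  next
    case (Suc n)
    then obtain w where w: "(u, w) \<in> parcs G" "d w v < d u v"
      using descend[of u v] uv(2) by auto
    then have "d w v = n"
      using step[OF w(1) uv(2)] Suc.hyps(2) by simp
    then show ?case
      using Suc.hyps w(1) in_arcsD2 has_walk_Suc_iff[OF graph] by metis
  qed
  ultimately show "gdist G u v = ereal (real (d u v))"
    by (simp add: gdist_eq_nat_iff[OF graph])
qed

lemma connected_graph_distance:
  assumes "pair_graph G" "Digraph_Component.connected (with_proj G)"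
  obtains d where "graph_distance G d"
proof
  interpret pair_graph G by fact
  show "graph_distance G (\<lambda>u v. LEAST k. has_walk G k u v)"
  proof (rule graph_distance.intro)
    fix u v assume "u \<in> pverts G" "v \<in> pverts G"
    moreover have "strongly_connected (with_proj G)"
      using symmetric_connected_imp_strongly_connected sym_arcs assms(2) by blast
    ultimately have "\<exists>k. has_walk G k u v"
      unfolding has_walk_def strongly_connected_def reachable_awalk by auto
    then show "gdist G u v = ereal (real (LEAST k. has_walk G k u v))"
      unfolding gdist_eq_nat_iff[OF assms(1)] by (auto intro: LeastI_ex Least_le)
  qed (fact assms)
qed

lemma connected_nonempty: "Digraph_Component.connected (with_proj G) \<Longrightarrow> pverts G \<noteq> {}"
  by (simp add: connected_conv)

lemma CDDR_iff_balanced: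
  fixes G :: "('a::finite) pair_pre_digraph"
  assumes "graph_distance G d"
  shows "CDDR i G \<longleftrightarrow> balanced (pverts G) d (\<lambda>u w. d u w = i)"
proof -
  interpret graph_distance G d by fact
  have "{w \<in> pverts G. gdist G u w = ereal (real i) \<and> gdist G w v = ereal (real j)}
      = {w \<in> pverts G. d u w = i \<and> d w v = j}" if "u \<in> pverts G" "v \<in> pverts G" for u v j
    using that gdist_eq_d by auto
  then show ?thesis
    by (auto simp: CDDR_iff_card[OF graph] balanced_def)
qed

lemma CDDR_if_balanced_gdist:
  fixes G :: "('a::finite) pair_pre_digraph"
  assumes "pair_graph G" "balanced (pverts G) (gdist G) (\<lambda>u w. gdist G u w = ereal (real i))"
  shows "CDDR i G"
  using assms by (simp add: CDDR_iff_card balanced_def)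

section \<open>Two connected graphs\<close>

locale two_graphs =
  G: graph_distance G d + H: graph_distance H e
  for G :: "('a::finite) pair_pre_digraph" and d
    and H :: "('b::finite) pair_pre_digraph" and e +
  assumes nonempty: "pverts G \<noteq> {}" "pverts H \<noteq> {}"
begin

abbreviation "VG \<equiv> pverts G"
abbreviation "VH \<equiv> pverts H"

lemma balanced_Id_G: "balanced VG d (=)"
  by (rule balanced_Id) (rule G.d_sym)

lemma balanced_Id_H: "balanced VH e (=)"
  by (rule balanced_Id) (rule H.d_sym)

lemmas tensor = balanced_tensor[OF G.finite_V H.finite_V]

lemma finite_VG_VH: "finite (VG \<times> VH)"
  using G.finite_V H.finite_V by simp

text \<open>
  How commutation descends to the first factor: among the vertices \<open>(w, z)\<close> counted between \<open>(u, x)\<close> and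
  \<open>(v, x)\<close>, those with \<open>w \<noteq> u\<close> contribute the wanted count times the size of \<open>B\<close>, which is positive,
  and those with \<open>w = u\<close> contribute a number that is symmetric in \<open>u\<close> and \<open>v\<close>.
\<close>

lemma balanced_first_factor:
  assumes bal: "balanced (VG \<times> VH) D R" and x: "x \<in> VH"
    and B: "x \<in> B" "B \<subseteq> VH"
    and slice: "\<And>u v w z. u \<in> VG \<Longrightarrow> v \<in> VG \<Longrightarrow> w \<in> VG \<Longrightarrow> z \<in> VH \<Longrightarrow>
      R (u, x) (w, z) \<and> D (w, z) (v, x) = c \<longleftrightarrow>
        d u w = 1 \<and> d w v = j \<and> z \<in> B \<or> u = w \<and> d w v = k \<and> z \<in> C"
    and C: "C \<subseteq> VH"
    and uv: "u \<in> VG" "v \<in> VG"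
  shows "card {w \<in> VG. d u w = 1 \<and> d w v = j} = card {w \<in> VG. d v w = 1 \<and> d w u = j}"
proof -
  have fin: "finite B" "finite C"
    using B(2) C H.finite_V finite_subset by blast+
  have count: "card {p \<in> VG \<times> VH. R (u, x) p \<and> D p (v, x) = c}
      = card {w \<in> VG. d u w = 1 \<and> d w v = j} * card B + card {w \<in> VG. u = w \<and> d w v = k} * card C"
    if "u \<in> VG" "v \<in> VG" for u v
  proof -
    have "{p \<in> VG \<times> VH. R (u, x) p \<and> D p (v, x) = c}
        = {w \<in> VG. d u w = 1 \<and> d w v = j} \<times> B \<union> {w \<in> VG. u = w \<and> d w v = k} \<times> C"
      using slice[OF that] B(2) C by (intro set_eqI) (auto simp del: One_nat_def)
    then show ?thesis
      using that G.finite_V fin by (simp add: card_Un_disjoint card_cartesian_product disjoint_iff)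
  qed
  have "card {p \<in> VG \<times> VH. R (u, x) p \<and> D p (v, x) = c} = card {p \<in> VG \<times> VH. R (v, x) p \<and> D p (u, x) = c}"
    using uv x by (intro balancedD[OF bal]) auto
  moreover have "card {w \<in> VG. u = w \<and> d w v = k} = card {w \<in> VG. v = w \<and> d w u = k}"
    by (rule balancedD[OF balanced_Id_G uv])
  moreover have "card B \<noteq> 0"
    using B(1) fin by auto
  ultimately show ?thesis
    using count[OF uv] count[OF uv(2,1)] by simp
qed

section \<open>The strong product\<close>

abbreviation "strong_dist p q \<equiv> max (d (fst p) (fst q)) (e (snd p) (snd q))"

lemma strong_distance: "graph_distance (strong_product G H) (\<lambda>p q. strong_dist p q)"
proof (rule graph_distanceI)
  show "pair_graph (strong_product G H)"
    by (rule pair_graph_strong_product[OF G.graph H.graph])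
next
  fix p q assume "p \<in> pverts (strong_product G H)" "q \<in> pverts (strong_product G H)"
  then show "strong_dist p q = 0 \<longleftrightarrow> p = q"
    by (auto simp: strong_product_def G.d_eq_0_iff H.d_eq_0_iff)
next
  fix p r q assume "(p, r) \<in> parcs (strong_product G H)" "q \<in> pverts (strong_product G H)"
  then show "strong_dist p q \<le> Suc (strong_dist r q)"
    using G.d_step_le[of "fst p" "fst r" "fst q"] H.d_step_le[of "snd p" "snd r" "snd q"]
    by (auto simp: strong_product_def)
next
  fix p q
  assume "p \<in> pverts (strong_product G H)" "q \<in> pverts (strong_product G H)" "strong_dist p q \<noteq> 0"
  then obtain u x v y where pq: "p = (u, x)" "q = (v, y)" "u \<in> VG" "x \<in> VH" "v \<in> VG" "y \<in> VH"
    "d u v \<noteq> 0 \<or> e x y \<noteq> 0"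
    by (auto simp: strong_product_def)
  \<comment> \<open>Each coordinate that has not arrived moves one step closer, and the others stay.\<close>
  have G_step: "\<exists>w. (d u v = 0 \<and> w = u \<or> (u, w) \<in> parcs G \<and> Suc (d w v) = d u v)"
    using G.d_descend[OF pq(3,5)] by (metis not0_implies_Suc)
  have H_step: "\<exists>z. (e x y = 0 \<and> z = x \<or> (x, z) \<in> parcs H \<and> Suc (e z y) = e x y)"
    using H.d_descend[OF pq(4,6)] by (metis not0_implies_Suc)
  from G_step H_step obtain w z where "d u v = 0 \<and> w = u \<or> (u, w) \<in> parcs G \<and> Suc (d w v) = d u v"
    "e x y = 0 \<and> z = x \<or> (x, z) \<in> parcs H \<and> Suc (e z y) = e x y"
    by blast
  then show "\<exists>r. (p, r) \<in> parcs (strong_product G H) \<and> strong_dist r q < strong_dist p q"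
    using pq G.arcD H.arcD by (intro exI[of _ "(w, z)"]) (auto simp: strong_product_def)
qed

lemma CDDR_strong_iff:
  "CDDR 1 (strong_product G H) \<longleftrightarrow>
     balanced (VG \<times> VH) (\<lambda>p q. strong_dist p q) (\<lambda>p q. strong_dist p q = 1)"
  using CDDR_iff_balanced[OF strong_distance] by (simp add: strong_product_def)

lemma CDDR_strongI:
  assumes "CDDR 1 G" "CDDR 1 H"
  shows "CDDR 1 (strong_product G H)"
proof -
  have R: "balanced VG d (\<lambda>u w. d u w = 1)" and S: "balanced VH e (\<lambda>u w. e u w = 1)"
    using assms CDDR_iff_balanced[OF G.graph_distance_axioms] CDDR_iff_balanced[OF H.graph_distance_axioms]
    by auto
  have "balanced (VG \<times> VH) (\<lambda>p q. strong_dist p q)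
      (\<lambda>p q. ((d (fst p) (fst q) = 1 \<and> e (snd p) (snd q) = 1) \<or> (d (fst p) (fst q) = 1 \<and> snd p = snd q))
        \<or> (fst p = fst q \<and> e (snd p) (snd q) = 1))"
    using finite_VG_VH
    by (intro balanced_disjoint_union_iff[THEN iffD2] tensor[where F = max] R S balanced_Id_G balanced_Id_H)
       auto
  moreover have "strong_dist p q = 1 \<longleftrightarrow>
      ((d (fst p) (fst q) = 1 \<and> e (snd p) (snd q) = 1) \<or> (d (fst p) (fst q) = 1 \<and> snd p = snd q))
        \<or> (fst p = fst q \<and> e (snd p) (snd q) = 1)" if "p \<in> VG \<times> VH" "q \<in> VG \<times> VH" for p q
    using that G.d_eq_0_iff[of "fst p" "fst q"] H.d_eq_0_iff[of "snd p" "snd q"]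
    by (auto simp: max_def)
  ultimately show ?thesis
    unfolding CDDR_strong_iff by (subst balanced_cong[where R' = "\<lambda>p q.
      ((d (fst p) (fst q) = 1 \<and> e (snd p) (snd q) = 1) \<or> (d (fst p) (fst q) = 1 \<and> snd p = snd q))
        \<or> (fst p = fst q \<and> e (snd p) (snd q) = 1)", OF refl]) blast+
qed

text \<open>
  A step from \<open>x\<close> leads to distance at most one from \<open>x\<close>, so for \<open>j \<ge> 2\<close> the second coordinate
  does not affect whether the distance in the product is \<open>j\<close>.
\<close>

lemma CDDR_strong_first:
  assumes "CDDR 1 (strong_product G H)"
  shows "CDDR 1 G"
proof -
  obtain x where x: "x \<in> VH"
    using nonempty by blast
  have "balanced VG d (\<lambda>u w. d u w = 1)"
  proof (rule balanced_shellI[OF G.d_sym G.d_eq_0_iff])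
    fix u v j assume uv: "u \<in> VG" "v \<in> VG" and j: "j \<noteq> 0" "j \<noteq> (1::nat)"
    show "card {w \<in> VG. d u w = 1 \<and> d w v = j} = card {w \<in> VG. d v w = 1 \<and> d w u = j}"
    proof (rule balanced_first_factor[OF assms[unfolded CDDR_strong_iff] x, OF _ _ _ _ uv])
      show "x \<in> {z \<in> VH. e x z \<le> 1}" "{z \<in> VH. e x z \<le> 1} \<subseteq> VH" "{z \<in> VH. e x z = 1} \<subseteq> VH"
        using x by auto
      fix u v w z assume "u \<in> VG" "v \<in> VG" "w \<in> VG" "z \<in> VH"
      then show "strong_dist (u, x) (w, z) = 1 \<and> strong_dist (w, z) (v, x) = j \<longleftrightarrow>
          d u w = 1 \<and> d w v = j \<and> z \<in> {z \<in> VH. e x z \<le> 1} \<or> u = w \<and> d w v = j \<and> z \<in> {z \<in> VH. e x z = 1}"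
        using x j H.d_sym[of z x] G.d_eq_0_iff[of u w] by (auto simp: max_def)
    qed
  qed
  then show ?thesis
    using CDDR_iff_balanced[OF G.graph_distance_axioms] by simp
qed

section \<open>The Cartesian product\<close>

abbreviation "cartesian_dist p q \<equiv> d (fst p) (fst q) + e (snd p) (snd q)"

lemma cartesian_distance: "graph_distance (cartesian_product G H) (\<lambda>p q. cartesian_dist p q)"
proof (rule graph_distanceI)
  show "pair_graph (cartesian_product G H)"
    by (rule pair_graph_cartesian_product[OF G.graph H.graph])
next
  fix p q assume "p \<in> pverts (cartesian_product G H)" "q \<in> pverts (cartesian_product G H)"
  then show "cartesian_dist p q = 0 \<longleftrightarrow> p = q"
    by (auto simp: cartesian_product_def G.d_eq_0_iff H.d_eq_0_iff)
next
  fix p r q assume "(p, r) \<in> parcs (cartesian_product G H)" "q \<in> pverts (cartesian_product G H)"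
  then show "cartesian_dist p q \<le> Suc (cartesian_dist r q)"
    using G.d_step_le[of "fst p" "fst r" "fst q"] H.d_step_le[of "snd p" "snd r" "snd q"]
    by (auto simp: cartesian_product_def)
next
  fix p q
  assume "p \<in> pverts (cartesian_product G H)" "q \<in> pverts (cartesian_product G H)" "cartesian_dist p q \<noteq> 0"
  then obtain u x v y where pq: "p = (u, x)" "q = (v, y)" "u \<in> VG" "x \<in> VH" "v \<in> VG" "y \<in> VH"
    "d u v \<noteq> 0 \<or> e x y \<noteq> 0"
    by (auto simp: cartesian_product_def)
  show "\<exists>r. (p, r) \<in> parcs (cartesian_product G H) \<and> cartesian_dist r q < cartesian_dist p q"
  proof (cases "d u v = 0")
    case True
    then obtain z where "(x, z) \<in> parcs H" "Suc (e z y) = e x y"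
      using H.d_descend[OF pq(4,6)] pq(7) by (metis not0_implies_Suc)
    then show ?thesis
      using pq G.arcD H.arcD by (intro exI[of _ "(u, z)"]) (auto simp: cartesian_product_def)
  next
    case False
    then obtain w where "(u, w) \<in> parcs G" "Suc (d w v) = d u v"
      using G.d_descend[OF pq(3,5)] by (metis not0_implies_Suc)
    then show ?thesis
      using pq G.arcD H.arcD by (intro exI[of _ "(w, x)"]) (auto simp: cartesian_product_def)
  qed
qed

lemma CDDR_cartesian_iff:
  "CDDR 1 (cartesian_product G H) \<longleftrightarrow>
     balanced (VG \<times> VH) (\<lambda>p q. cartesian_dist p q) (\<lambda>p q. cartesian_dist p q = 1)"
  using CDDR_iff_balanced[OF cartesian_distance] by (simp add: cartesian_product_def)

lemma CDDR_cartesianI: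
  assumes "CDDR 1 G" "CDDR 1 H"
  shows "CDDR 1 (cartesian_product G H)"
proof -
  have R: "balanced VG d (\<lambda>u w. d u w = 1)" and S: "balanced VH e (\<lambda>u w. e u w = 1)"
    using assms CDDR_iff_balanced[OF G.graph_distance_axioms] CDDR_iff_balanced[OF H.graph_distance_axioms]
    by auto
  have "balanced (VG \<times> VH) (\<lambda>p q. cartesian_dist p q)
      (\<lambda>p q. (d (fst p) (fst q) = 1 \<and> snd p = snd q) \<or> (fst p = fst q \<and> e (snd p) (snd q) = 1))"
    using finite_VG_VH
    by (intro balanced_disjoint_union_iff[THEN iffD2] tensor[where F = "(+)"] R S balanced_Id_G balanced_Id_H)
       auto
  moreover have "cartesian_dist p q = 1 \<longleftrightarrow>
      (d (fst p) (fst q) = 1 \<and> snd p = snd q) \<or> (fst p = fst q \<and> e (snd p) (snd q) = 1)"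
    if "p \<in> VG \<times> VH" "q \<in> VG \<times> VH" for p q
    using that G.d_eq_0_iff[of "fst p" "fst q"] H.d_eq_0_iff[of "snd p" "snd q"]
    by (auto simp: add_is_1)
  ultimately show ?thesis
    unfolding CDDR_cartesian_iff by (subst balanced_cong[where R' = "\<lambda>p q.
      (d (fst p) (fst q) = 1 \<and> snd p = snd q) \<or> (fst p = fst q \<and> e (snd p) (snd q) = 1)", OF refl]) blast+
qed

lemma CDDR_cartesian_first:
  assumes "CDDR 1 (cartesian_product G H)"
  shows "CDDR 1 G"
proof -
  obtain x where x: "x \<in> VH"
    using nonempty by blast
  have "balanced VG d (\<lambda>u w. d u w = 1)"
  proof (rule balanced_shellI[OF G.d_sym G.d_eq_0_iff])
    fix u v j assume uv: "u \<in> VG" "v \<in> VG" and j: "j \<noteq> (0::nat)"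
    show "card {w \<in> VG. d u w = 1 \<and> d w v = j} = card {w \<in> VG. d v w = 1 \<and> d w u = j}"
    proof (rule balanced_first_factor[OF assms[unfolded CDDR_cartesian_iff] x, OF _ _ _ _ uv])
      show "x \<in> {x}" "{x} \<subseteq> VH" "{z \<in> VH. e x z = 1} \<subseteq> VH"
        using x by auto
      fix u v w z assume "u \<in> VG" "v \<in> VG" "w \<in> VG" "z \<in> VH"
      then show "cartesian_dist (u, x) (w, z) = 1 \<and> cartesian_dist (w, z) (v, x) = j \<longleftrightarrow>
          d u w = 1 \<and> d w v = j \<and> z \<in> {x} \<or> u = w \<and> d w v = j - 1 \<and> z \<in> {z \<in> VH. e x z = 1}"
        using x j H.d_sym[of z x] G.d_eq_0_iff[of u w] H.d_eq_0_iff[of x z] by (auto simp: add_is_1)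
    qed
  qed
  then show ?thesis
    using CDDR_iff_balanced[OF G.graph_distance_axioms] by simp
qed

section \<open>The direct product\<close>

lemma has_walk_direct_iff:
  "has_walk (direct_product G H) k p q \<longleftrightarrow> has_walk G k (fst p) (fst q) \<and> has_walk H k (snd p) (snd q)"
proof (induction k arbitrary: p)
  case 0
  show ?case
    by (cases p; cases q)
       (auto simp: has_walk_0_iff G.graph H.graph pair_graph_direct_product, auto simp: direct_product_def)
next
  case (Suc k)
  have "(p, r) \<in> parcs (direct_product G H) \<longleftrightarrow> (fst p, fst r) \<in> parcs G \<and> (snd p, snd r) \<in> parcs H" for r
    using G.arcD H.arcD by (cases p; cases r) (auto simp: direct_product_def)
  then show ?case
    by (auto simp: has_walk_Suc_iff G.graph H.graph pair_graph_direct_product Suc.IH)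
qed

text \<open>
  Distances in a direct product may be infinite, so here the classes are those of the extended real
  distance itself.
\<close>

lemma CDDR_directI:
  assumes "CDDR 1 G" "CDDR 1 H" "DWR G" "DWR H"
  shows "CDDR 1 (direct_product G H)"
proof (rule CDDR_if_balanced_gdist)
  let ?P = "direct_product G H"
  show graph: "pair_graph ?P"
    by (rule pair_graph_direct_product[OF G.graph H.graph])
  \<comment> \<open>By distance walk regularity, the lengths of the walks between two vertices at distance \<open>a\<close>.\<close>
  define K where "K a k \<longleftrightarrow> (\<exists>u\<in>VG. \<exists>v\<in>VG. d u v = a \<and> has_walk G k u v)" for a k
  define L where "L a k \<longleftrightarrow> (\<exists>x\<in>VH. \<exists>y\<in>VH. e x y = a \<and> has_walk H k x y)" for a k
  have K: "has_walk G k u v \<longleftrightarrow> K (d u v) k" if "u \<in> VG" "v \<in> VG" for u v k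
    using assms(3) that G.gdist_eq_d unfolding DWR_def K_def by metis
  have L: "has_walk H k x y \<longleftrightarrow> L (e x y) k" if "x \<in> VH" "y \<in> VH" for x y k
    using assms(4) that H.gdist_eq_d unfolding DWR_def L_def by metis
  define F where "F a b = (INF k\<in>{k. K a k \<and> L b k}. ereal (real k))" for a b
  have "balanced (VG \<times> VH) (\<lambda>p q. F (d (fst p) (fst q)) (e (snd p) (snd q)))
      (\<lambda>p q. d (fst p) (fst q) = 1 \<and> e (snd p) (snd q) = 1)"
    using assms(1,2) CDDR_iff_balanced[OF G.graph_distance_axioms] CDDR_iff_balanced[OF H.graph_distance_axioms]
    by (intro tensor) auto
  moreover have "gdist ?P p q = F (d (fst p) (fst q)) (e (snd p) (snd q))"
    if "p \<in> VG \<times> VH" "q \<in> VG \<times> VH" for p q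
    using that by (auto simp: gdist_eq_INF_has_walk[OF graph] has_walk_direct_iff F_def K L)
  moreover have "gdist ?P p q = ereal (real 1) \<longleftrightarrow> d (fst p) (fst q) = 1 \<and> e (snd p) (snd q) = 1"
    if "p \<in> VG \<times> VH" "q \<in> VG \<times> VH" for p q
    using that G.d_eq_1_iff[of "fst p" "fst q"] H.d_eq_1_iff[of "snd p" "snd q"]
    unfolding gdist_eq_one_iff[OF graph] by (auto simp: direct_product_def)
  ultimately have "balanced (VG \<times> VH) (gdist ?P) (\<lambda>p q. gdist ?P p q = ereal (real 1))"
    by (subst balanced_cong[where d' = "\<lambda>p q. F (d (fst p) (fst q)) (e (snd p) (snd q))"
          and R' = "\<lambda>p q. d (fst p) (fst q) = 1 \<and> e (snd p) (snd q) = 1"]) blast+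
  then show "balanced (pverts ?P) (gdist ?P) (\<lambda>p q. gdist ?P p q = ereal (real 1))"
    by (simp add: direct_product_def)
qed

section \<open>Exchanging the factors\<close>

lemma two_graphs_swap: "two_graphs H e G d"
  using nonempty by unfold_locales auto

lemma CDDR_strong_second:
  assumes "CDDR 1 (strong_product G H)"
  shows "CDDR 1 H"
proof -
  interpret swapped: two_graphs H e G d by (rule two_graphs_swap)
  have "balanced (VH \<times> VG) (\<lambda>p q. swapped.strong_dist p q) (\<lambda>p q. swapped.strong_dist p q = 1)"
    using balanced_swap[OF assms[unfolded CDDR_strong_iff]] by (simp add: max.commute)
  then show ?thesis
    unfolding swapped.CDDR_strong_iff[symmetric] by (rule swapped.CDDR_strong_first)
qed

lemma CDDR_cartesian_second:
  assumes "CDDR 1 (cartesian_product G H)"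
  shows "CDDR 1 H"
proof -
  interpret swapped: two_graphs H e G d by (rule two_graphs_swap)
  have "balanced (VH \<times> VG) (\<lambda>p q. swapped.cartesian_dist p q) (\<lambda>p q. swapped.cartesian_dist p q = 1)"
    using balanced_swap[OF assms[unfolded CDDR_cartesian_iff]] by (simp add: add.commute)
  then show ?thesis
    unfolding swapped.CDDR_cartesian_iff[symmetric] by (rule swapped.CDDR_cartesian_first)
qed

section \<open>The lexicographic product\<close>

text \<open>
  The distance in the lexicographic product of two vertices in the same copy of \<open>H\<close>: nonadjacent ones
  are joined through any vertex of a neighbouring copy.
\<close>

definition trunc :: "'b \<Rightarrow> 'b \<Rightarrow> nat" where
  "trunc x y = min (e x y) 2"

abbreviation "lex_dist p q \<equiv>
  (if d (fst p) (fst q) = 0 then trunc (snd p) (snd q) else d (fst p) (fst q))"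

lemma trunc_sym: "x \<in> VH \<Longrightarrow> y \<in> VH \<Longrightarrow> trunc x y = trunc y x"
  by (simp add: trunc_def H.d_sym)

lemma trunc_cases: "trunc x y = 0 \<or> trunc x y = 1 \<or> trunc x y = 2"
  by (auto simp: trunc_def)

lemma trunc_eq_0_iff: "x \<in> VH \<Longrightarrow> y \<in> VH \<Longrightarrow> trunc x y = 0 \<longleftrightarrow> x = y"
  using H.d_eq_0_iff by (auto simp: trunc_def min_def)

lemma trunc_self [simp]: "x \<in> VH \<Longrightarrow> trunc x x = 0"
  by (simp add: trunc_eq_0_iff)

lemma trunc_eq_1_iff: "x \<in> VH \<Longrightarrow> y \<in> VH \<Longrightarrow> trunc x y = 1 \<longleftrightarrow> (x, y) \<in> parcs H"
  using H.d_eq_1_iff[of x y] by (auto simp: trunc_def min_def)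

lemma exists_neighbour:
  assumes "card VG \<ge> 2" "u \<in> VG"
  obtains w where "w \<in> VG" "(u, w) \<in> parcs G"
proof -
  have "\<not> VG \<subseteq> {u}"
    using assms(1) card_mono[of "{u}" VG] by auto
  then obtain v where "v \<in> VG" "v \<noteq> u"
    by blast
  then obtain n where "d u v = Suc n"
    using G.d_eq_0_iff[OF assms(2)] not0_implies_Suc by metis
  then show ?thesis
    using that G.d_descend[OF assms(2) \<open>v \<in> VG\<close>] G.arcD by metis
qed

lemma lex_distance:
  assumes "card VG \<ge> 2"
  shows "graph_distance (lexicographic_product G H) (\<lambda>p q. lex_dist p q)"
proof (rule graph_distanceI)
  show "pair_graph (lexicographic_product G H)"
    by (rule pair_graph_lexicographic_product[OF G.graph H.graph])
next
  fix p q assume "p \<in> pverts (lexicographic_product G H)" "q \<in> pverts (lexicographic_product G H)"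
  then show "lex_dist p q = 0 \<longleftrightarrow> p = q"
    using trunc_eq_0_iff by (auto simp: lexicographic_product_def G.d_eq_0_iff)
next
  fix p r q assume "(p, r) \<in> parcs (lexicographic_product G H)" "q \<in> pverts (lexicographic_product G H)"
  then obtain u x w z v y where pq: "p = (u, x)" "r = (w, z)" "q = (v, y)" "v \<in> VG" "y \<in> VH"
    "u \<in> VG" "x \<in> VH" "w \<in> VG" "z \<in> VH" "(u, w) \<in> parcs G \<or> u = w \<and> (x, z) \<in> parcs H"
    by (auto simp: lexicographic_product_def)
  show "lex_dist p q \<le> Suc (lex_dist r q)"
  proof (cases "(u, w) \<in> parcs G")
    case True
    then have "d u v \<le> Suc (d w v)" "d u v = 0 \<Longrightarrow> d w v \<noteq> 0"
      using pq G.d_step_le[of u w v] G.d_eq_0_iff[of u v] G.d_eq_0_iff[of w v] G.no_loops' by auto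
    then show ?thesis
      using pq trunc_cases[of x y] by auto
  next
    case False
    then show ?thesis
      using pq H.d_step_le[of x z y] by (auto simp: trunc_def)
  qed
next
  fix p q assume "p \<in> pverts (lexicographic_product G H)" "q \<in> pverts (lexicographic_product G H)"
    "lex_dist p q \<noteq> 0"
  then obtain u x v y where pq: "p = (u, x)" "q = (v, y)" "u \<in> VG" "x \<in> VH" "v \<in> VG" "y \<in> VH"
    "lex_dist (u, x) (v, y) \<noteq> 0"
    by (auto simp: lexicographic_product_def)
  show "\<exists>r. (p, r) \<in> parcs (lexicographic_product G H) \<and> lex_dist r q < lex_dist p q"
  proof (cases "d u v = 0")
    case False
    then obtain n where n: "d u v = Suc n"
      using not0_implies_Suc by blast
    then obtain w where w: "(u, w) \<in> parcs G" "d w v = n"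
      using G.d_descend[OF pq(3,5)] by blast
    then have "lex_dist (w, y) (v, y) < lex_dist (u, x) (v, y)"
      using n pq trunc_eq_0_iff[of y y] by auto
    then show ?thesis
      using pq G.arcD w by (intro exI[of _ "(w, y)"]) (auto simp: lexicographic_product_def)
  next
    case True
    then have v: "v = u"
      using pq G.d_eq_0_iff by auto
    show ?thesis
    proof (cases "e x y = 1")
      case True
      then have "lex_dist (u, y) q < lex_dist p q" "(x, y) \<in> parcs H"
        using pq v H.d_eq_1_iff[of x y] by (simp_all add: trunc_def)
      then show ?thesis
        using pq v by (intro exI[of _ "(u, y)"]) (simp add: lexicographic_product_def)
    next
      case False
      then have far: "lex_dist p q = 2"
        using pq v by (auto simp: trunc_def min_def)
      obtain w where w: "w \<in> VG" "(u, w) \<in> parcs G"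
        using exists_neighbour[OF assms pq(3)] by blast
      then have "lex_dist (w, x) q = 1"
        using pq v G.d_eq_1_iff[of u w] G.d_sym[of u w] by auto
      then show ?thesis
        using far pq w by (intro exI[of _ "(w, x)"]) (auto simp: lexicographic_product_def)
    qed
  qed
qed

text \<open>
  Within a copy of \<open>H\<close> distances are at most two, so a larger distance comes from \<open>G\<close>; moving along a
  shortest path then realises every smaller value.
\<close>

lemma exists_at_distance:
  assumes "card VG \<ge> 2" "i > 2" "ereal (real i) \<le> diam (lexicographic_product G H)"
  obtains u v where "u \<in> VG" "v \<in> VG" "d u v = i"
proof -
  interpret L: graph_distance "lexicographic_product G H" "\<lambda>p q. lex_dist p q"
    by (rule lex_distance[OF assms(1)])
  have "\<exists>p\<in>VG \<times> VH. \<exists>q\<in>VG \<times> VH. lex_dist p q \<ge> i"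
  proof (rule ccontr)
    assume none: "\<not> ?thesis"
    have below: "lex_dist p q \<le> i - 1" if "p \<in> VG \<times> VH" "q \<in> VG \<times> VH" for p q
    proof -
      have "\<not> i \<le> lex_dist p q"
        using that none by blast
      then show ?thesis
        by linarith
    qed
    have "diam (lexicographic_product G H) \<le> ereal (real (i - 1))"
      unfolding diam_def using below L.gdist_eq_d
      by (intro SUP_least) (simp add: lexicographic_product_def)
    then have "ereal (real i) \<le> ereal (real (i - 1))"
      using assms(3) by (rule order_trans[rotated])
    then show False
      using assms(2) by simp
  qed
  then obtain u v where uv: "u \<in> VG" "v \<in> VG" "d u v \<ge> i"
    using assms(2) by (auto simp: trunc_def split: if_splits)
  have "\<exists>u\<in>VG. d u v = i" if "u \<in> VG" "d u v = i + k" for u k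
    using that
  proof (induction k arbitrary: u)
    case (Suc k)
    then obtain w where "(u, w) \<in> parcs G" "d w v = i + k"
      using G.d_descend[OF Suc.prems(1) uv(2), of "i + k"] by auto
    then show ?case
      using Suc.IH G.arcD by blast
  qed auto
  then show ?thesis
    using that uv le_Suc_ex by metis
qed

lemma CDDR_lex_iff:
  assumes "card VG \<ge> 2"
  shows "CDDR i (lexicographic_product G H) \<longleftrightarrow>
     balanced (VG \<times> VH) (\<lambda>p q. lex_dist p q) (\<lambda>p q. lex_dist p q = i)"
  using CDDR_iff_balanced[OF lex_distance[OF assms]] by (simp add: lexicographic_product_def)

lemma regular_iff:
  "regular H \<longleftrightarrow> (\<forall>x\<in>VH. \<forall>y\<in>VH. card {z \<in> VH. trunc x z = 1} = card {z \<in> VH. trunc y z = 1})"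
proof -
  have "out_degree (with_proj H) x = card {z \<in> VH. trunc x z = 1}" if "x \<in> VH" for x
  proof -
    have "out_arcs (with_proj H) x = Pair x ` {z \<in> VH. trunc x z = 1}"
      using that trunc_eq_1_iff[OF that] H.arcD by (auto simp: out_arcs_def)
    then show ?thesis
      by (simp add: out_degree_def card_image inj_on_def)
  qed
  then have "regular H \<longleftrightarrow> (\<exists>k. \<forall>x\<in>VH. card {z \<in> VH. trunc x z = 1} = k)"
    by (simp add: regular_def)
  also have "\<dots> \<longleftrightarrow> (\<forall>x\<in>VH. \<forall>y\<in>VH. card {z \<in> VH. trunc x z = 1} = card {z \<in> VH. trunc y z = 1})"
    (is "(\<exists>k. \<forall>x\<in>VH. ?deg x = k) \<longleftrightarrow> _")
  proof
    obtain x where "x \<in> VH"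
      using nonempty by blast
    moreover assume "\<forall>x\<in>VH. \<forall>y\<in>VH. ?deg x = ?deg y"
    ultimately have "\<forall>y\<in>VH. ?deg y = ?deg x"
      by blast
    then show "\<exists>k. \<forall>x\<in>VH. ?deg x = k" ..
  qed metis
  finally show ?thesis .
qed

lemma card_trunc_sum:
  assumes "x \<in> VH" "A \<subseteq> VH"
  shows "card A = card {z \<in> A. trunc z x = 0} + card {z \<in> A. trunc z x = 1} + card {z \<in> A. trunc z x = 2}"
proof -
  have fin: "finite A"
    using assms(2) H.finite_V finite_subset by blast
  have "A = {z \<in> A. trunc z x = 0} \<union> {z \<in> A. trunc z x = 1} \<union> {z \<in> A. trunc z x = 2}"
    using trunc_cases by blast
  then have "card A = card ({z \<in> A. trunc z x = 0} \<union> {z \<in> A. trunc z x = 1} \<union> {z \<in> A. trunc z x = 2})"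
    by simp
  also have "\<dots> = card {z \<in> A. trunc z x = 0} + card {z \<in> A. trunc z x = 1} + card {z \<in> A. trunc z x = 2}"
    using fin by (subst card_Un_disjoint, simp, simp, fastforce)+ simp
  finally show ?thesis .
qed

text \<open>
  A graph is regular if and only if its complement is.
\<close>

lemma regular_iff_two:
  "regular H \<longleftrightarrow> (\<forall>x\<in>VH. \<forall>y\<in>VH. card {z \<in> VH. trunc x z = 2} = card {z \<in> VH. trunc y z = 2})"
proof -
  have card_shells: "card VH = 1 + card {z \<in> VH. trunc x z = 1} + card {z \<in> VH. trunc x z = 2}" if "x \<in> VH" for x
  proof -
    have "{z \<in> VH. trunc z x = 0} = {x}"
      using trunc_eq_0_iff that by auto
    moreover have "{z \<in> VH. trunc z x = c} = {z \<in> VH. trunc x z = c}" for c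
      using trunc_sym that by auto
    ultimately show ?thesis
      using card_trunc_sum[OF that subset_refl] by simp
  qed
  have "card {z \<in> VH. trunc x z = 1} = card {z \<in> VH. trunc y z = 1} \<longleftrightarrow>
      card {z \<in> VH. trunc x z = 2} = card {z \<in> VH. trunc y z = 2}" if "x \<in> VH" "y \<in> VH" for x y
    using card_shells[OF that(1)] card_shells[OF that(2)] by linarith
  then show ?thesis
    unfolding regular_iff by (intro ball_cong refl)
qed

lemma balanced_trunc_all:
  assumes "regular H"
  shows "balanced VH trunc (\<lambda>x y. True)"
proof (rule balancedI)
  fix x y c assume xy: "x \<in> VH" "y \<in> VH"
  have flip: "{z \<in> VH. True \<and> trunc z a = c} = {z \<in> VH. trunc a z = c}" if "a \<in> VH" for a
    using trunc_sym[of _ a] that by (intro Collect_cong) metis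
  consider "c = 0" | "c = 1" | "c = 2" | "c > 2"
    by linarith
  then have "card {z \<in> VH. trunc y z = c} = card {z \<in> VH. trunc x z = c}"
  proof cases
    case 1
    then have "{z \<in> VH. trunc y z = c} = {y}" "{z \<in> VH. trunc x z = c} = {x}"
      using trunc_eq_0_iff xy by auto
    then show ?thesis by simp
  next
    case 2
    then show ?thesis using assms xy unfolding regular_iff by blast
  next
    case 3
    then show ?thesis using assms xy unfolding regular_iff_two by blast
  next
    case 4
    then have "trunc a z \<noteq> c" for a z
      by (auto simp: trunc_def)
    then show ?thesis by simp
  qed
  then show "card {z \<in> VH. True \<and> trunc z y = c} = card {z \<in> VH. True \<and> trunc z x = c}"
    using flip xy by simp
qed

text \<open>
  The matrix form of this lemma: the adjacency matrix of a regular graph commutes with the all-ones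
  matrix, hence with the matrix of nonadjacent pairs of distinct vertices.
\<close>

lemma balanced_trunc_1:
  assumes "regular H"
  shows "balanced VH trunc (\<lambda>x y. trunc x y = 1)"
proof (rule balanced_shellI[OF trunc_sym trunc_eq_0_iff])
  fix x y and j :: nat
  assume xy: "x \<in> VH" "y \<in> VH" and j: "j \<noteq> 0" "j \<noteq> 1"
  have split: "card {z \<in> VH. trunc a z = 1} = (if trunc a b = 1 then 1 else 0)
      + card {z \<in> VH. trunc a z = 1 \<and> trunc z b = 1} + card {z \<in> VH. trunc a z = 1 \<and> trunc z b = 2}"
    if "a \<in> VH" "b \<in> VH" for a b
  proof -
    have "{z \<in> {z \<in> VH. trunc a z = 1}. trunc z b = 0} = (if trunc a b = 1 then {b} else {})"
      using trunc_eq_0_iff that by auto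
    then show ?thesis
      using card_trunc_sum[OF that(2), of "{z \<in> VH. trunc a z = 1}"] by (auto simp: conj_assoc)
  qed
  have "{z \<in> VH. trunc x z = 1 \<and> trunc z y = 1} = {z \<in> VH. trunc y z = 1 \<and> trunc z x = 1}"
    using trunc_sym xy by auto
  moreover have "card {z \<in> VH. trunc x z = 1} = card {z \<in> VH. trunc y z = 1}"
    using assms xy unfolding regular_iff by blast
  ultimately have two: "card {z \<in> VH. trunc x z = 1 \<and> trunc z y = 2} = card {z \<in> VH. trunc y z = 1 \<and> trunc z x = 2}"
    using split[OF xy] split[OF xy(2,1)] trunc_sym[OF xy] by simp
  show "card {z \<in> VH. trunc x z = 1 \<and> trunc z y = j} = card {z \<in> VH. trunc y z = 1 \<and> trunc z x = j}"
  proof (cases "j = 2")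
    case False
    then have "trunc a b \<noteq> j" for a b
      using j False trunc_cases[of a b] by auto
    then show ?thesis by simp
  qed (use two in simp)
qed

lemma balanced_trunc:
  assumes "regular H" "i \<noteq> 0"
  shows "balanced VH trunc (\<lambda>x y. trunc x y = i)"
proof -
  have "balanced VH trunc (=)"
    by (rule balanced_Id) (rule trunc_sym)
  then have "balanced VH trunc (\<lambda>x y. trunc x y = 1 \<or> x = y)"
    using balanced_trunc_1[OF assms(1)] H.finite_V trunc_eq_0_iff
    by (intro balanced_disjoint_union_iff[THEN iffD2]) auto
  moreover have "balanced VH trunc (\<lambda>x y. trunc x y = 2 \<or> (trunc x y = 1 \<or> x = y))"
    using trunc_eq_0_iff trunc_cases
    by (intro balanced_cong[THEN iffD1, OF _ _ balanced_trunc_all[OF assms(1)]]) metis+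
  ultimately have two: "balanced VH trunc (\<lambda>x y. trunc x y = 2)"
    using H.finite_V trunc_eq_0_iff by (subst (asm) balanced_disjoint_union_iff) auto
  consider "i = 1" | "i = 2" | "i > 2"
    using assms(2) by linarith
  then show ?thesis
  proof cases
    case 3
    then have "trunc x y \<noteq> i" for x y
      by (auto simp: trunc_def)
    then show ?thesis by (simp add: balanced_def)
  qed (use two balanced_trunc_1[OF assms(1)] in simp_all)
qed

lemma CDDR_lexI:
  assumes "card VG \<ge> 2" "i \<noteq> 0" "CDDR i G" "regular H"
  shows "CDDR i (lexicographic_product G H)"
proof -
  have R: "balanced VG d (\<lambda>u w. d u w = i)"
    using assms(3) CDDR_iff_balanced[OF G.graph_distance_axioms] by simp
  have "balanced (VG \<times> VH) (\<lambda>p q. lex_dist p q)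
      (\<lambda>p q. (d (fst p) (fst q) = i \<and> True) \<or> (fst p = fst q \<and> trunc (snd p) (snd q) = i))"
    using finite_VG_VH assms(2)
    by (intro balanced_disjoint_union_iff[THEN iffD2]
          tensor[where F = "\<lambda>a b. if a = 0 then b else a" and e = trunc]
          R balanced_Id_G balanced_trunc_all balanced_trunc assms(4)) auto
  moreover have "lex_dist p q = i \<longleftrightarrow>
      (d (fst p) (fst q) = i \<and> True) \<or> (fst p = fst q \<and> trunc (snd p) (snd q) = i)"
    if "p \<in> VG \<times> VH" "q \<in> VG \<times> VH" for p q
    using that G.d_eq_0_iff[of "fst p" "fst q"] assms(2) by auto
  ultimately show ?thesis
    unfolding CDDR_lex_iff[OF assms(1)] by (subst balanced_cong[where R' = "\<lambda>p q.
      (d (fst p) (fst q) = i \<and> True) \<or> (fst p = fst q \<and> trunc (snd p) (snd q) = i)", OF refl]) blast+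
qed

text \<open>
  The vertices counted lie in copies of \<open>H\<close> over a vertex \<open>w\<close>. A copy with \<open>w\<close> different from \<open>u\<close> and
  \<open>v\<close> counts completely or not at all; the copies over \<open>u\<close> and \<open>v\<close> give the two correction terms.
\<close>

lemma card_lex_shells:
  assumes mem: "u \<in> VG" "v \<in> VG" "x \<in> VH" "y \<in> VH" and neq: "u \<noteq> v" and ij: "i \<noteq> 0" "j \<noteq> 0"
  shows "card {p \<in> VG \<times> VH. lex_dist (u, x) p = i \<and> lex_dist p (v, y) = j}
    = card {w \<in> VG. d u w = i \<and> d w v = j} * card VH
      + (if d u v = j then card {z \<in> VH. trunc x z = i} else 0)
      + (if d u v = i then card {z \<in> VH. trunc y z = j} else 0)"
proof -
  let ?A = "{w \<in> VG. d u w = i \<and> d w v = j}"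
  let ?B = "{z \<in> VH. d u v = j \<and> trunc x z = i}" and ?C = "{z \<in> VH. d u v = i \<and> trunc y z = j}"
  define Q where "Q p \<longleftrightarrow> lex_dist (u, x) p = i \<and> lex_dist p (v, y) = j" for p
  have "Q (w, z) \<longleftrightarrow>
      d u w = i \<and> d w v = j \<or> w = u \<and> d u v = j \<and> trunc x z = i \<or> w = v \<and> d u v = i \<and> trunc y z = j"
    if "w \<in> VG" "z \<in> VH" for w z
    using that mem neq ij trunc_sym[of y z] G.d_eq_0_iff[of u w] G.d_eq_0_iff[of w v] G.d_eq_0_iff[of u v]
    unfolding Q_def by auto
  then have set: "{p \<in> VG \<times> VH. Q p} = ?A \<times> VH \<union> {u} \<times> ?B \<union> {v} \<times> ?C"
    using mem by (intro set_eqI) auto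
  have "card {p \<in> VG \<times> VH. Q p} = card (?A \<times> VH) + card ({u} \<times> ?B) + card ({v} \<times> ?C)"
    unfolding set using mem neq ij G.finite_V H.finite_V by (simp add: card_Un_disjoint disjoint_iff)
  moreover have "card (?A \<times> VH) = card ?A * card VH" "card ({u} \<times> ?B) = card ?B" "card ({v} \<times> ?C) = card ?C"
    by (simp_all add: card_cartesian_product)
  moreover have "card ?B = (if d u v = j then card {z \<in> VH. trunc x z = i} else 0)"
    by simp
  moreover have "card ?C = (if d u v = i then card {z \<in> VH. trunc y z = j} else 0)"
    by simp
  ultimately show ?thesis
    by (simp only: Q_def)
qed

lemma CDDR_lexD:
  assumes card: "card VG \<ge> 2" and i: "i \<noteq> 0" "ereal (real i) \<le> diam (lexicographic_product G H)"
    and bal: "CDDR i (lexicographic_product G H)"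
  shows "CDDR i G" "regular H"
proof -
  have swap: "card {p \<in> VG \<times> VH. lex_dist (u, x) p = i \<and> lex_dist p (v, y) = j}
      = card {p \<in> VG \<times> VH. lex_dist (v, y) p = i \<and> lex_dist p (u, x) = j}"
    if "u \<in> VG" "v \<in> VG" "x \<in> VH" "y \<in> VH" for u v x y j
    using that by (intro balancedD[OF bal[unfolded CDDR_lex_iff[OF card]]]) auto
  obtain x where x: "x \<in> VH"
    using nonempty by blast
  have G_bal: "balanced VG d (\<lambda>u w. d u w = i)"
  proof (rule balanced_shellI[OF G.d_sym G.d_eq_0_iff])
    fix u v j assume uv: "u \<in> VG" "v \<in> VG" and j: "j \<noteq> (0::nat)"
    show "card {w \<in> VG. d u w = i \<and> d w v = j} = card {w \<in> VG. d v w = i \<and> d w u = j}"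
    proof (cases "u = v")
      case False
      then have "card {w \<in> VG. d u w = i \<and> d w v = j} * card VH
          = card {w \<in> VG. d v w = i \<and> d w u = j} * card VH"
        using swap[OF uv x x, of j] G.d_sym[OF uv]
        unfolding card_lex_shells[OF uv x x False i(1) j]
          card_lex_shells[OF uv(2,1) x x False[symmetric] i(1) j] by simp
      moreover have "card VH \<noteq> 0"
        using x H.finite_V by auto
      ultimately show ?thesis by simp
    qed simp
  qed
  then show "CDDR i G"
    using CDDR_iff_balanced[OF G.graph_distance_axioms] by simp
  \<comment> \<open>What is left of \<open>card_lex_shells\<close> after cancelling the counts of \<open>G\<close>.\<close>
  have degrees: "(if d u v = j then card {z \<in> VH. trunc x z = i} else 0)
        + (if d u v = i then card {z \<in> VH. trunc y z = j} else 0)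
      = (if d u v = j then card {z \<in> VH. trunc y z = i} else 0)
        + (if d u v = i then card {z \<in> VH. trunc x z = j} else 0)"
    if "u \<in> VG" "v \<in> VG" "x \<in> VH" "y \<in> VH" "u \<noteq> v" "j \<noteq> 0" for u v x y j
    using swap[OF that(1-4), of j] balancedD[OF G_bal that(1,2), of j] G.d_sym[OF that(1,2)]
    unfolding card_lex_shells[OF that(1-5) i(1) that(6)]
      card_lex_shells[OF that(2,1,4,3) that(5)[symmetric] i(1) that(6)] by simp
  obtain u where u: "u \<in> VG"
    using nonempty by blast
  obtain w where w: "w \<in> VG" "(u, w) \<in> parcs G"
    using exists_neighbour[OF card u] by blast
  have uw: "u \<noteq> w" "d u w = 1"
    using u w G.no_loops' G.d_eq_1_iff by auto
  \<comment> \<open>A distance \<open>j\<close> and a pair of vertices of \<open>G\<close> are needed for which exactly one of the two terms in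
    \<open>degrees\<close> survives, and it compares shells of radius one or two. For \<open>i \<le> 2\<close> an adjacent pair serves, with
    \<open>j = 3 - i\<close>; for larger \<open>i\<close> a pair at distance \<open>i\<close>, with \<open>j = 1\<close>.\<close>
  consider "i = 1" | "i = 2" | "i > 2"
    using i(1) by linarith
  then show "regular H"
  proof cases
    case 1
    have "card {z \<in> VH. trunc x z = 2} = card {z \<in> VH. trunc y z = 2}" if "x \<in> VH" "y \<in> VH" for x y
      using degrees[OF u w(1) that uw(1), of 2] uw 1 by simp
    then show ?thesis
      unfolding regular_iff_two by blast
  next
    case 2
    have "card {z \<in> VH. trunc x z = 2} = card {z \<in> VH. trunc y z = 2}" if "x \<in> VH" "y \<in> VH" for x y
      using degrees[OF u w(1) that uw(1), of 1] uw 2 by simp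
    then show ?thesis
      unfolding regular_iff_two by blast
  next
    case 3
    obtain v v' where v: "v \<in> VG" "v' \<in> VG" "d v v' = i"
      using exists_at_distance[OF card 3 i(2)] by blast
    have "card {z \<in> VH. trunc x z = 1} = card {z \<in> VH. trunc y z = 1}" if "x \<in> VH" "y \<in> VH" for x y
      using degrees[OF v(1,2) that, of 1] v 3 G.d_eq_0_iff[OF v(1,2)] by auto
    then show ?thesis
      unfolding regular_iff by blast
  qed
qed

end

theorem theorem7p5:
  fixes G :: "('a::finite) pair_pre_digraph" and H :: "('b::finite) pair_pre_digraph"
  assumes "pair_graph G" and "Digraph_Component.connected (with_proj G)"
    and "pair_graph H" and "Digraph_Component.connected (with_proj H)"
  shows
    "(CDDR 1 G \<and> CDDR 1 H \<longleftrightarrow> CDDR 1 (strong_product G H)) \<and>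
     (CDDR 1 G \<and> CDDR 1 H \<longleftrightarrow> CDDR 1 (cartesian_product G H)) \<and>
     (CDDR 1 G \<and> CDDR 1 H \<and> DWR G \<and> DWR H \<and> (\<not> bipartite G \<or> \<not> bipartite H) \<longrightarrow>
        CDDR 1 (direct_product G H)) \<and>
     (\<forall>i::nat. card (pverts G) \<ge> 2 \<and> 1 \<le> i \<and>
        ereal (real i) \<le> diam (lexicographic_product G H) \<longrightarrow>
        (CDDR i G \<and> regular H \<longleftrightarrow> CDDR i (lexicographic_product G H)))"
proof -
  obtain d where d: "graph_distance G d"
    using connected_graph_distance[OF assms(1,2)] .
  obtain e where e: "graph_distance H e"
    using connected_graph_distance[OF assms(3,4)] .
  interpret two_graphs G d H e
    using connected_nonempty[OF assms(2)] connected_nonempty[OF assms(4)]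
    by (intro two_graphs.intro two_graphs_axioms.intro d e)
  have "CDDR 1 G \<and> CDDR 1 H \<longleftrightarrow> CDDR 1 (strong_product G H)"
    using CDDR_strongI CDDR_strong_first CDDR_strong_second by blast
  moreover have "CDDR 1 G \<and> CDDR 1 H \<longleftrightarrow> CDDR 1 (cartesian_product G H)"
    using CDDR_cartesianI CDDR_cartesian_first CDDR_cartesian_second by blast
  moreover have "CDDR i G \<and> regular H \<longleftrightarrow> CDDR i (lexicographic_product G H)"
    if "card (pverts G) \<ge> 2" "1 \<le> i" "ereal (real i) \<le> diam (lexicographic_product G H)" for i
    using that CDDR_lexI[of i] CDDR_lexD[of i] by auto
  ultimately show ?thesis
    using CDDR_directI by blast
qed

end
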